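(* Let $X$ be a set. In $\mathcal{P}_X$, with $\leq$ the Mitsch order and $\supseteq$ reverse inclusion: (i) $\supseteq\circ\leq$ is a preorder on $\mathcal{P}_X$; (ii) $\leq\circ\supseteq$ is contained in $\supseteq\circ\leq$; (iii) $\supseteq\circ\leq$ is the join of $\supseteq$ and $\leq$ in the lattice of preorders on $\mathcal{P}_X$.
   Context: The partition monoid $\mathcal{P}_X$ consists of all set partitions of the disjoint union $X\sqcup X=X_0\cup X_1$ of two copies of $X$. An element $a\in\mathcal{P}_X$ is identified with the graph on $X_0\cup X_1$ in which $\{i,j\}$ is an edge iff $i,j$ lie in the same block of $a$ (a union of cliques). Product: given $a,b\in\mathcal{P}_X$, regard $a$ as a graph on $X_0\cup X_1$ and $b$ as a graph on $X_1\cup X_2$ (with $X_0,X_1,X_2$ pairwise disjoint copies of $X$), and let $\Gamma$ be the union of these graphs on $X_0\cup X_1\cup X_2$; then $ab$ is the partition of $X_0\cup X_2$ (identified with $X\sqcup X$) in which $i,j\in X_0\cup X_2$ are in the same block iff there is a path in $\Gamma$ from $i$ to $j$. Inclusion order: $a\subseteq b$ iff every edge of $a$ is an edge of $b$ (i.e. $a$ refines $b$); $\supseteq$ is the reverse. The Mitsch order $\leq$ on any semigroup $S$ is: $a\leq b$ iff $a=b$ or there are $x,y\in S$ with $a=ax=bx=yb$; here $S=\mathcal{P}_X$. For relations $\rho,\sigma$ on the set $\mathcal{P}_X$, $a\,(\rho\circ\sigma)\,b$ iff there is $c\in\mathcal{P}_X$ with $a\,\rho\,c$ and $c\,\sigma\,b$.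 A preorder is a reflexive transitive relation; preorders on $\mathcal{P}_X$, ordered by containment, form a lattice, in which the join of two preorders is the least preorder containing both. *)

theory Defs
  imports "HOL-Library.Disjoint_Sets" "HOL-Algebra.Group"
begin

(* The copy X_k of X is X \<times> {k}, so the disjoint union of two copies of X is X \<times> {0, 1}. *)

definition partitions :: "'a set \<Rightarrow> ('a \<times> nat) set set set" where
  "partitions X = {a. partition_on (X \<times> {0, 1}) a}"

(* Edges as ordered pairs, loops included; loops affect neither reachability nor the inclusion
   order, since two partitions of the same set have the same loops. *)

definition edges :: "'b set set \<Rightarrow> ('b \<times> 'b) set" where
  "edges a = {(i, j). \<exists>B\<in>a. i \<in> B \<and> j \<in> B}"

definition lower_shift :: "'a \<times> nat \<Rightarrow> 'a \<times> nat" where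
  "lower_shift p = (fst p, Suc (snd p))"

definition product_graph ::
  "('a \<times> nat) set set \<Rightarrow> ('a \<times> nat) set set \<Rightarrow> (('a \<times> nat) \<times> ('a \<times> nat)) set" where
  "product_graph a b = edges a \<union> map_prod lower_shift lower_shift ` edges b"

(* The identification of X_0 \<union> X_1 with X_0 \<union> X_2. *)

definition outer :: "'a \<times> nat \<Rightarrow> 'a \<times> nat" where
  "outer p = (fst p, 2 * snd p)"

definition partition_mult ::
  "'a set \<Rightarrow> ('a \<times> nat) set set \<Rightarrow> ('a \<times> nat) set set \<Rightarrow> ('a \<times> nat) set set" where
  "partition_mult X a b =
     (X \<times> {0, 1}) // {(p, q). p \<in> X \<times> {0, 1} \<and> q \<in> X \<times> {0, 1} \<and>
                               (outer p, outer q) \<in> (product_graph a b)\<^sup>*}"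

definition partition_monoid :: "'a set \<Rightarrow> ('a \<times> nat) set set monoid" where
  "partition_monoid X =
     \<lparr>carrier = partitions X,
      mult = partition_mult X,
      one = (\<lambda>x. {(x, 0), (x, 1)}) ` X\<rparr>"

definition reverse_inclusion ::
  "'a set \<Rightarrow> (('a \<times> nat) set set \<times> ('a \<times> nat) set set) set" where
  "reverse_inclusion X =
     {(a, b). a \<in> partitions X \<and> b \<in> partitions X \<and> edges b \<subseteq> edges a}"

(* Only the semigroup structure of S is used. *)

definition mitsch_order :: "('s, 'm) monoid_scheme \<Rightarrow> ('s \<times> 's) set" where
  "mitsch_order S =
     {(a, b). a \<in> carrier S \<and> b \<in> carrier S \<and>
        (a = b \<or> (\<exists>x\<in>carrier S. \<exists>y\<in>carrier S.
           a = a \<otimes>\<^bsub>S\<^esub> x \<and> a = b \<otimes>\<^bsub>S\<^esub> x \<and> a = y \<otimes>\<^bsub>S\<^esub> b))}"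

definition is_preorder_join ::
  "'s set \<Rightarrow> ('s \<times> 's) set \<Rightarrow> ('s \<times> 's) set \<Rightarrow> ('s \<times> 's) set \<Rightarrow> bool" where
  "is_preorder_join A r s t \<longleftrightarrow>
     preorder_on A r \<and> preorder_on A s \<and> preorder_on A t \<and> r \<subseteq> t \<and> s \<subseteq> t \<and>
     (\<forall>u. preorder_on A u \<longrightarrow> r \<subseteq> u \<longrightarrow> s \<subseteq> u \<longrightarrow> t \<subseteq> u)"

end

(* Let ker a and coker a be the restrictions of the equivalence relation a to X_0 and to X_1.
   Multiplying on the right can only enlarge ker, and multiplying on the left can only enlarge
   coker.  Conversely, cutting all transversal blocks of b yields an element below b in the Mitsch
   order which is contained in every a with ker b \<subseteq> ker a and coker b \<subseteq> coker a.  Hence a is related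
   to b by the composite relation iff ker b \<subseteq> ker a and coker b \<subseteq> coker a; the preorder
   axioms and the inclusion (ii) are immediate from this.  The Mitsch order is itself a preorder
   because multiplication is associative: (ab)c and a(bc) both describe reachability in the graph
   formed by a, b and c on four copies of X. *)
theory Submission
  imports Defs
begin

section \<open>Partitions as equivalence relations\<close>

lemma equiv_edges:
  assumes "a \<in> partitions X"
  shows "equiv (X \<times> {0, 1}) (edges a)"
  using equiv_partition_on[of "X \<times> {0, 1}" a] assms by (simp add: partitions_def edges_def)

lemma quotient_edges:
  assumes "a \<in> partitions X"
  shows "(X \<times> {0, 1}) // edges a = a"
  using partition_on_eq_quotient[of "X \<times> {0, 1}" a] assms by (simp add: partitions_def edges_def)

text \<open>A partition is recovered from its edges as a quotient, so identities between products
  can be proved by comparing edge relations.\<close>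

lemma edges_inject:
  assumes "a \<in> partitions X" "b \<in> partitions X" "edges a = edges b"
  shows "a = b"
  using quotient_edges[OF assms(1)] quotient_edges[OF assms(2)] assms(3) by simp

lemma quotient_in_partitions:
  assumes "equiv (X \<times> {0, 1}) r"
  shows "(X \<times> {0, 1}) // r \<in> partitions X"
  using partition_on_quotient[OF assms] by (simp add: partitions_def)

lemma edges_quotient:
  assumes "equiv A r"
  shows "edges (A // r) = r"
proof -
  have "r \<subseteq> A \<times> A" "refl_on A r" "sym r" "trans r"
    using assms by (auto elim: equivE)
  then show ?thesis
    unfolding edges_def quotient_def
    by (auto simp: refl_on_def dest: symD transD)
qed

section \<open>Reachability under relabelling and contraction\<close>

lemma rtrancl_map_prod_inj:
  assumes "inj f"
  shows "(f p, f q) \<in> (map_prod f f ` r)\<^sup>* \<longleftrightarrow> (p, q) \<in> r\<^sup>*"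
proof
  have "\<exists>q'. y = f q' \<and> (p, q') \<in> r\<^sup>*" if "(f p, y) \<in> (map_prod f f ` r)\<^sup>*" for y
    using that
  proof induction
    case (step y z)
    then obtain q' where q': "y = f q'" "(p, q') \<in> r\<^sup>*" by blast
    from step(2) obtain u v where uv: "y = f u" "z = f v" "(u, v) \<in> r" by auto
    with q' assms have "u = q'" by (auto dest: injD)
    with q' uv show ?case by (auto intro: rtrancl_into_rtrancl)
  qed blast
  then show "(p, q) \<in> r\<^sup>*" if "(f p, f q) \<in> (map_prod f f ` r)\<^sup>*"
    using that assms by (metis injD)
  show "(f p, f q) \<in> (map_prod f f ` r)\<^sup>*" if "(p, q) \<in> r\<^sup>*"
    using that
  proof induction
    case (step y z)
    then have "(f y, f z) \<in> map_prod f f ` r" by force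
    with step show ?case by (blast intro: rtrancl_into_rtrancl)
  qed simp
qed

(* Maximal segments of a path inside R may be contracted to single edges between points of V,
   since a path can only enter or leave R through V. *)
lemma rtrancl_Un_contract:
  assumes V: "V \<subseteq> W" and S: "S \<subseteq> W \<times> W" and R: "Field R \<inter> W \<subseteq> V"
    and p: "p \<in> W" and q: "q \<in> W"
  shows "(p, q) \<in> (R\<^sup>* \<inter> V \<times> V \<union> S)\<^sup>* \<longleftrightarrow> (p, q) \<in> (R \<union> S)\<^sup>*"
proof
  have sub: "R\<^sup>* \<inter> V \<times> V \<union> S \<subseteq> (R \<union> S)\<^sup>*"
    using rtrancl_mono[of R "R \<union> S"] by auto
  then show "(p, q) \<in> (R \<union> S)\<^sup>*" if "(p, q) \<in> (R\<^sup>* \<inter> V \<times> V \<union> S)\<^sup>*"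
    using rtrancl_subset_rtrancl[OF sub] that by blast
next
  let ?T = "R\<^sup>* \<inter> V \<times> V \<union> S"
  \<comment> \<open>A path in \<open>R\<close> between distinct points has both ends in
    \<open>Field R\<close>. If they also lie in \<open>W\<close>, they lie in \<open>V\<close>, so
    the path is a single contracted edge.\<close>
  have end_in_V: "(p, y) \<in> ?T\<^sup>*" if "(p, w) \<in> ?T\<^sup>*" "(w, y) \<in> R\<^sup>*" "w \<in> W" "y \<in> W" for w y
  proof (cases "w = y")
    case False
    with that(2) have "w \<in> Field R" "y \<in> Field R"
      by (auto simp: Field_def elim: converse_rtranclE rtranclE)
    with that R have "(w, y) \<in> ?T" by blast
    with that(1) show ?thesis by (rule rtrancl_into_rtrancl)
  qed (use that in simp)
  \<comment> \<open>Invariant: a contracted path up to some \<open>w\<close> in \<open>W\<close>,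
    followed by an unfinished segment in \<open>R\<close>. An edge of \<open>S\<close> starts in
    \<open>W\<close>, so it forces the segment to be closed first.\<close>
  have "\<exists>w\<in>W. (p, w) \<in> ?T\<^sup>* \<and> (w, y) \<in> R\<^sup>*" if "(p, y) \<in> (R \<union> S)\<^sup>*" for y
    using that
  proof induction
    case base
    show ?case using p by blast
  next
    case (step y z)
    then obtain w where w: "w \<in> W" "(p, w) \<in> ?T\<^sup>*" "(w, y) \<in> R\<^sup>*" by blast
    show ?case
    proof (cases "(y, z) \<in> R")
      case True
      with w show ?thesis by (meson rtrancl_into_rtrancl)
    next
      case False
      with step(2) S have yz: "(y, z) \<in> S" "y \<in> W" "z \<in> W" by auto
      with end_in_V[OF w(2,3,1)] have "(p, z) \<in> ?T\<^sup>*"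
        by (blast intro: rtrancl_into_rtrancl)
      with yz show ?thesis by blast
    qed
  qed
  then show "(p, q) \<in> ?T\<^sup>*" if "(p, q) \<in> (R \<union> S)\<^sup>*"
    using that end_in_V q by blast
qed

section \<open>The product of two partitions\<close>

lemma sym_product_graph:
  assumes "a \<in> partitions X" "b \<in> partitions X"
  shows "sym (product_graph a b)"
proof -
  have "sym (map_prod f f ` r)" if "sym r" for f :: "'a \<times> nat \<Rightarrow> 'a \<times> nat" and r
  proof (rule symI)
    fix u v assume "(u, v) \<in> map_prod f f ` r"
    then obtain p q where "u = f p" "v = f q" "(p, q) \<in> r" by auto
    with that show "(v, u) \<in> map_prod f f ` r"
      using image_eqI[of "(v, u)" "map_prod f f" "(q, p)" r] by (simp add: symD)
  qed
  then show ?thesis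
    using assms[THEN equiv_edges] by (auto simp: product_graph_def equiv_def intro: sym_Un)
qed

lemma equiv_product:
  assumes "a \<in> partitions X" "b \<in> partitions X"
  shows "equiv (X \<times> {0, 1}) {(p, q). p \<in> X \<times> {0, 1} \<and> q \<in> X \<times> {0, 1} \<and>
                               (outer p, outer q) \<in> (product_graph a b)\<^sup>*}"
  using sym_rtrancl[OF sym_product_graph[OF assms]]
  by (intro equivI) (auto simp: refl_on_def intro!: symI transI dest: symD rtrancl_trans)

lemma partition_mult_closed:
  assumes "a \<in> partitions X" "b \<in> partitions X"
  shows "partition_mult X a b \<in> partitions X"
  unfolding partition_mult_def by (rule quotient_in_partitions[OF equiv_product[OF assms]])

lemma edges_partition_mult:
  assumes "a \<in> partitions X" "b \<in> partitions X"
  shows "edges (partition_mult X a b) = {(p, q). p \<in> X \<times> {0, 1} \<and> q \<in> X \<times> {0, 1} \<and>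
                               (outer p, outer q) \<in> (product_graph a b)\<^sup>*}"
  unfolding partition_mult_def by (rule edges_quotient[OF equiv_product[OF assms]])

lemma inj_lower_shift: "inj lower_shift"
  by (auto simp: inj_def lower_shift_def prod_eq_iff)

section \<open>Associativity of the product\<close>

text \<open>On four copies of \<open>X\<close>, \<open>a\<close> joins levels 0 and 1,
  \<open>b\<close> levels 1 and 2, \<open>c\<close> levels 2 and 3. The outer levels are 0 and 3,
  whence the factor 3 in the next two lemmas.\<close>

definition triple_graph ::
  "('a \<times> nat) set set \<Rightarrow> ('a \<times> nat) set set \<Rightarrow> ('a \<times> nat) set set \<Rightarrow> (('a \<times> nat) \<times> ('a \<times> nat)) set"
  where "triple_graph a b c = edges a \<union> map_prod lower_shift lower_shift ` product_graph b c"

text \<open>Forming \<open>ab\<close> first contracts the paths of the triple graph that run through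
  \<open>a\<close> and \<open>b\<close>. This part meets the levels 0, 2, 3 only in 0 and 2, so
  \<open>rtrancl_Un_contract\<close> applies.\<close>

lemma edges_mult_mult_left:
  assumes a: "a \<in> partitions X" and b: "b \<in> partitions X" and c: "c \<in> partitions X"
  shows "edges (partition_mult X (partition_mult X a b) c) =
    {(p, q). p \<in> X \<times> {0, 1} \<and> q \<in> X \<times> {0, 1} \<and>
       ((fst p, 3 * snd p), (fst q, 3 * snd q)) \<in> (triple_graph a b c)\<^sup>*}"
proof -
  (* Relabels the three levels of the graph of (ab)c as the levels 0, 2, 3 of the triple graph. *)
  define m :: "'a \<times> nat \<Rightarrow> 'a \<times> nat" where "m p = (fst p, if snd p = 0 then 0 else Suc (snd p))" for p
  have m: "inj m" by (auto simp: inj_def m_def prod_eq_iff split: if_splits)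
  let ?R = "product_graph a b"
  let ?S = "map_prod lower_shift lower_shift ` map_prod lower_shift lower_shift ` edges c"
  let ?V = "X \<times> {0, 2}" and ?W = "X \<times> {0, 2, 3}"
  have sub: "edges a \<subseteq> (X \<times> {0, 1}) \<times> (X \<times> {0, 1})" "edges b \<subseteq> (X \<times> {0, 1}) \<times> (X \<times> {0, 1})"
    "edges c \<subseteq> (X \<times> {0, 1}) \<times> (X \<times> {0, 1})"
    using a b c by (auto dest!: equiv_edges elim!: equivE)
  \<comment> \<open>On levels 0 and 1 the map \<open>m\<close> agrees with
    \<open>outer\<close>.\<close>
  have "map_prod m m ` edges (partition_mult X a b) = ?R\<^sup>* \<inter> ?V \<times> ?V"
    unfolding edges_partition_mult[OF a b]
    by (force simp: m_def outer_def image_iff numeral_2_eq_2)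
  \<comment> \<open>On levels 1 and 2 the map \<open>m\<close> is one more shift, which puts
    \<open>c\<close> on levels 2 and 3.\<close>
  moreover have "map_prod m m ` map_prod lower_shift lower_shift ` edges c = ?S"
    by (simp add: image_image m_def lower_shift_def map_prod_def split_def)
  ultimately have img: "map_prod m m ` product_graph (partition_mult X a b) c = ?R\<^sup>* \<inter> ?V \<times> ?V \<union> ?S"
    by (simp add: product_graph_def image_Un)
  have T: "triple_graph a b c = ?R \<union> ?S"
    by (simp add: triple_graph_def product_graph_def image_Un Un_assoc)
  have "?S \<subseteq> ?W \<times> ?W"
    using sub by (fastforce simp: lower_shift_def)
  moreover have "Field ?R \<inter> ?W \<subseteq> ?V"
    using sub by (fastforce simp: product_graph_def lower_shift_def Field_def)
  ultimately have contract: "(u, v) \<in> (?R\<^sup>* \<inter> ?V \<times> ?V \<union> ?S)\<^sup>* \<longleftrightarrow> (u, v) \<in> (triple_graph a b c)\<^sup>*"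
    if "u \<in> ?W" "v \<in> ?W" for u v
    unfolding T using that by (intro rtrancl_Un_contract) auto
  have mo: "m (outer p) = (fst p, 3 * snd p)" if "p \<in> X \<times> {0, 1}" for p
    using that by (auto simp: m_def outer_def)
  have "(outer p, outer q) \<in> (product_graph (partition_mult X a b) c)\<^sup>* \<longleftrightarrow>
      ((fst p, 3 * snd p), (fst q, 3 * snd q)) \<in> (triple_graph a b c)\<^sup>*"
    if p: "p \<in> X \<times> {0, 1}" and q: "q \<in> X \<times> {0, 1}" for p q
    using rtrancl_map_prod_inj[OF m, of "outer p" "outer q" "product_graph (partition_mult X a b) c"]
      contract[of "m (outer p)" "m (outer q)"] p q
    unfolding img mo[OF p] mo[OF q] by auto
  then show ?thesis
    unfolding edges_partition_mult[OF partition_mult_closed[OF a b] c] by blast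
qed

text \<open>Here the part formed by \<open>b\<close> and \<open>c\<close> is contracted. It meets
  the levels 0, 1, 3 only in 1 and 3, while the edges of \<open>a\<close> stay in place.\<close>

lemma edges_mult_mult_right:
  assumes a: "a \<in> partitions X" and b: "b \<in> partitions X" and c: "c \<in> partitions X"
  shows "edges (partition_mult X a (partition_mult X b c)) =
    {(p, q). p \<in> X \<times> {0, 1} \<and> q \<in> X \<times> {0, 1} \<and>
       ((fst p, 3 * snd p), (fst q, 3 * snd q)) \<in> (triple_graph a b c)\<^sup>*}"
proof -
  (* Relabels the three levels of the graph of a(bc) as the levels 0, 1, 3 of the triple graph. *)
  define m :: "'a \<times> nat \<Rightarrow> 'a \<times> nat" where "m p = (fst p, if snd p \<le> 1 then snd p else Suc (snd p))" for p
  have m: "inj m" by (auto simp: inj_def m_def prod_eq_iff split: if_splits)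
  let ?sh = "map_prod lower_shift lower_shift"
  let ?R = "?sh ` product_graph b c"
  let ?V = "X \<times> {1, 3}" and ?W = "X \<times> {0, 1, 3}"
  have sub: "edges a \<subseteq> (X \<times> {0, 1}) \<times> (X \<times> {0, 1})" "edges b \<subseteq> (X \<times> {0, 1}) \<times> (X \<times> {0, 1})"
    "edges c \<subseteq> (X \<times> {0, 1}) \<times> (X \<times> {0, 1})"
    using a b c by (auto dest!: equiv_edges elim!: equivE)
  \<comment> \<open>Both sides send level 0 to 1 and level 1 to 3, so the relabelled edges of
    \<open>bc\<close> express reachability in the shifted graph \<open>?R\<close>.\<close>
  have ms: "m (lower_shift p) = lower_shift (outer p)" if "p \<in> X \<times> {0, 1}" for p
    using that by (auto simp: m_def outer_def lower_shift_def)
  have V: "(\<lambda>p. lower_shift (outer p)) ` (X \<times> {0, 1}) = ?V"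
    by (force simp: outer_def lower_shift_def)
  have pairs: "{(g p, g q) | p q. p \<in> A \<and> q \<in> A \<and> (g p, g q) \<in> r} = r \<inter> g ` A \<times> g ` A"
    for A :: "('a \<times> nat) set" and g :: "'a \<times> nat \<Rightarrow> 'a \<times> nat" and r
    by blast
  have "edges (partition_mult X b c) \<subseteq> (X \<times> {0, 1}) \<times> (X \<times> {0, 1})"
    unfolding edges_partition_mult[OF b c] by blast
  then have "map_prod m m ` ?sh ` edges (partition_mult X b c) =
      (\<lambda>e. (lower_shift (outer (fst e)), lower_shift (outer (snd e)))) ` edges (partition_mult X b c)"
    unfolding image_image by (intro image_cong refl) (auto simp: ms)
  also have "\<dots> = {(lower_shift (outer p), lower_shift (outer q)) | p q.
      p \<in> X \<times> {0, 1} \<and> q \<in> X \<times> {0, 1} \<and> (lower_shift (outer p), lower_shift (outer q)) \<in> ?R\<^sup>*}"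
    unfolding rtrancl_map_prod_inj[OF inj_lower_shift] edges_partition_mult[OF b c] by force
  also have "\<dots> = ?R\<^sup>* \<inter> ?V \<times> ?V"
    unfolding pairs V ..
  finally have "map_prod m m ` ?sh ` edges (partition_mult X b c) = ?R\<^sup>* \<inter> ?V \<times> ?V" .
  moreover have "map_prod m m ` edges a = edges a"
  proof -
    have "map_prod m m e = e" if "e \<in> edges a" for e
      using that sub(1) by (auto simp: m_def)
    then show ?thesis by (simp add: image_cong)
  qed
  ultimately have img: "map_prod m m ` product_graph a (partition_mult X b c) = ?R\<^sup>* \<inter> ?V \<times> ?V \<union> edges a"
    by (simp add: product_graph_def image_Un Un_commute)
  have T: "triple_graph a b c = ?R \<union> edges a"
    by (auto simp: triple_graph_def)
  have "edges a \<subseteq> ?W \<times> ?W"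
    using sub by fastforce
  moreover have "Field ?R \<inter> ?W \<subseteq> ?V"
    using sub by (fastforce simp: product_graph_def lower_shift_def Field_def)
  ultimately have contract: "(u, v) \<in> (?R\<^sup>* \<inter> ?V \<times> ?V \<union> edges a)\<^sup>* \<longleftrightarrow> (u, v) \<in> (triple_graph a b c)\<^sup>*"
    if "u \<in> ?W" "v \<in> ?W" for u v
    unfolding T using that by (intro rtrancl_Un_contract) auto
  have mo: "m (outer p) = (fst p, 3 * snd p)" if "p \<in> X \<times> {0, 1}" for p
    using that by (auto simp: m_def outer_def)
  have "(outer p, outer q) \<in> (product_graph a (partition_mult X b c))\<^sup>* \<longleftrightarrow>
      ((fst p, 3 * snd p), (fst q, 3 * snd q)) \<in> (triple_graph a b c)\<^sup>*"
    if p: "p \<in> X \<times> {0, 1}" and q: "q \<in> X \<times> {0, 1}" for p q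
    using rtrancl_map_prod_inj[OF m, of "outer p" "outer q" "product_graph a (partition_mult X b c)"]
      contract[of "m (outer p)" "m (outer q)"] p q
    unfolding img mo[OF p] mo[OF q] by auto
  then show ?thesis
    unfolding edges_partition_mult[OF a partition_mult_closed[OF b c]] by blast
qed

lemma partition_mult_assoc:
  assumes "a \<in> partitions X" "b \<in> partitions X" "c \<in> partitions X"
  shows "partition_mult X (partition_mult X a b) c = partition_mult X a (partition_mult X b c)"
  using assms by (intro edges_inject[of _ X])
    (simp_all add: edges_mult_mult_left edges_mult_mult_right partition_mult_closed)

section \<open>The two given preorders\<close>

lemma preorder_on_mitsch_order:
  fixes S (structure)
  assumes closed: "\<And>x y. x \<in> carrier S \<Longrightarrow> y \<in> carrier S \<Longrightarrow> x \<otimes> y \<in> carrier S"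
    and assoc: "\<And>x y z. x \<in> carrier S \<Longrightarrow> y \<in> carrier S \<Longrightarrow> z \<in> carrier S \<Longrightarrow>
      (x \<otimes> y) \<otimes> z = x \<otimes> (y \<otimes> z)"
  shows "preorder_on (carrier S) (mitsch_order S)"
proof -
  have "trans (mitsch_order S)"
  proof (rule transI)
    fix a b c assume ab: "(a, b) \<in> mitsch_order S" and bc: "(b, c) \<in> mitsch_order S"
    show "(a, c) \<in> mitsch_order S"
    proof (cases "a = b \<or> b = c")
      case False
      with ab bc obtain x y u v where
        car: "a \<in> carrier S" "b \<in> carrier S" "c \<in> carrier S" "x \<in> carrier S" "y \<in> carrier S"
          "u \<in> carrier S" "v \<in> carrier S"
        and eq: "a = a \<otimes> x" "a = b \<otimes> x" "a = y \<otimes> b" "b = b \<otimes> u" "b = c \<otimes> u" "b = v \<otimes> c"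
        unfolding mitsch_order_def by blast
      \<comment> \<open>From \<open>a = y \<otimes> b\<close> and \<open>b = b \<otimes> u\<close>.
        This lets \<open>u \<otimes> x\<close> and \<open>y \<otimes> v\<close> serve as the
        multipliers for \<open>a\<close> and \<open>c\<close>.\<close>
      have "a \<otimes> u = a" using car eq by (metis assoc)
      then have "a = a \<otimes> (u \<otimes> x)" using car eq by (metis assoc)
      moreover have "a = c \<otimes> (u \<otimes> x)" using car eq by (metis assoc)
      moreover have "a = (y \<otimes> v) \<otimes> c" using car eq by (metis assoc)
      ultimately show ?thesis
        using car closed unfolding mitsch_order_def by blast
    qed (use ab bc in auto)
  qed
  then show ?thesis
    by (auto simp: preorder_on_def refl_on_def mitsch_order_def)
qed

lemma preorder_on_mitsch_order_partitions:
  "preorder_on (partitions X) (mitsch_order (partition_monoid X))"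
  using preorder_on_mitsch_order[of "partition_monoid X"]
  by (simp add: partition_monoid_def partition_mult_closed partition_mult_assoc)

lemma preorder_on_reverse_inclusion: "preorder_on (partitions X) (reverse_inclusion X)"
  by (auto simp: preorder_on_def refl_on_def reverse_inclusion_def intro!: transI)

section \<open>Kernels and cokernels\<close>

definition ker :: "('a \<times> nat) set set \<Rightarrow> ('a \<times> 'a) set" where
  "ker a = {(x, y). ((x, 0), (y, 0)) \<in> edges a}"

definition coker :: "('a \<times> nat) set set \<Rightarrow> ('a \<times> 'a) set" where
  "coker a = {(x, y). ((x, 1), (y, 1)) \<in> edges a}"

lemma equiv_ker:
  assumes "a \<in> partitions X"
  shows "equiv X (ker a)"
  using equiv_edges[OF assms]
  by (intro equivI) (auto simp: equiv_def ker_def refl_on_def intro!: symI transI dest: symD transD)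

lemma equiv_coker:
  assumes "a \<in> partitions X"
  shows "equiv X (coker a)"
  using equiv_edges[OF assms]
  by (intro equivI) (auto simp: equiv_def coker_def refl_on_def intro!: symI transI dest: symD transD)

text \<open>An edge of \<open>a\<close> within level 0 is an edge of the product graph, and
  \<open>outer\<close> fixes level 0.\<close>

lemma ker_subset_mult:
  assumes "a \<in> partitions X" "b \<in> partitions X"
  shows "ker a \<subseteq> ker (partition_mult X a b)"
  using assms equiv_ker[OF assms(1)]
  by (auto simp: ker_def edges_partition_mult outer_def product_graph_def equiv_def)

text \<open>On level 1, \<open>lower_shift\<close> and \<open>outer\<close> agree: both lead to
  level 2. Hence an edge of \<open>b\<close> there survives in the product.\<close>

lemma coker_subset_mult:
  assumes "a \<in> partitions X" "b \<in> partitions X"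
  shows "coker b \<subseteq> coker (partition_mult X a b)"
proof (rule subrelI)
  fix x y assume xy: "(x, y) \<in> coker b"
  then have "(lower_shift (x, 1), lower_shift (y, 1)) \<in> product_graph a b"
    by (force simp: product_graph_def coker_def)
  then have "(outer (x, 1), outer (y, 1)) \<in> (product_graph a b)\<^sup>*"
    by (auto simp: outer_def lower_shift_def numeral_2_eq_2)
  moreover have "x \<in> X" "y \<in> X"
    using xy equiv_coker[OF assms(2)] by (auto simp: equiv_def)
  ultimately show "(x, y) \<in> coker (partition_mult X a b)"
    using assms by (simp add: coker_def edges_partition_mult)
qed

text \<open>The factorisation \<open>a = bx\<close> gives the inclusion of kernels, and
  \<open>a = yb\<close> that of cokernels.\<close>

lemma mitsch_order_ker_coker:
  assumes "(a, b) \<in> mitsch_order (partition_monoid X)"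
  shows "ker b \<subseteq> ker a" "coker b \<subseteq> coker a"
  using assms ker_subset_mult[of b X] coker_subset_mult[of _ X b]
  by (auto simp: mitsch_order_def partition_monoid_def) blast+

lemma reverse_inclusion_ker_coker:
  assumes "(a, b) \<in> reverse_inclusion X"
  shows "ker b \<subseteq> ker a" "coker b \<subseteq> coker a"
  using assms by (auto simp: reverse_inclusion_def ker_def coker_def)

section \<open>Partitions without transversal blocks\<close>

definition level_relation :: "('a \<times> 'a) set \<Rightarrow> ('a \<times> 'a) set \<Rightarrow> (('a \<times> nat) \<times> ('a \<times> nat)) set" where
  "level_relation r s = {((x, i), (y, j)). i = 0 \<and> j = 0 \<and> (x, y) \<in> r \<or> i = 1 \<and> j = 1 \<and> (x, y) \<in> s}"

text \<open>For equivalences \<open>r\<close> and \<open>s\<close> on \<open>X\<close> this is the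
  finest partition with kernel \<open>r\<close> and cokernel \<open>s\<close>. With
  \<open>ker b\<close> and \<open>coker b\<close> it is \<open>b\<close> with its transversal blocks
  cut.\<close>

definition levels :: "'a set \<Rightarrow> ('a \<times> 'a) set \<Rightarrow> ('a \<times> 'a) set \<Rightarrow> ('a \<times> nat) set set" where
  "levels X r s = (X \<times> {0, 1}) // level_relation r s"

lemma lower_shift_level_relation:
  "map_prod lower_shift lower_shift ` level_relation r s =
    (\<lambda>(x, y). ((x, 1), (y, 1))) ` r \<union> (\<lambda>(x, y). ((x, 2), (y, 2))) ` s"
proof -
  have "level_relation r s = (\<lambda>(x, y). ((x, 0), (y, 0))) ` r \<union> (\<lambda>(x, y). ((x, 1), (y, 1))) ` s"
    by (auto simp: level_relation_def)
  then show ?thesis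
    by (simp add: image_Un image_image split_def lower_shift_def numeral_2_eq_2)
qed

lemma equiv_level_relation:
  assumes "equiv X r" "equiv X s"
  shows "equiv (X \<times> {0, 1}) (level_relation r s)"
  using assms unfolding equiv_def level_relation_def
  by (auto simp: refl_on_def intro!: symI transI dest: symD transD)

lemma levels_in_partitions:
  assumes "equiv X r" "equiv X s"
  shows "levels X r s \<in> partitions X"
  unfolding levels_def by (rule quotient_in_partitions[OF equiv_level_relation[OF assms]])

lemma edges_levels:
  assumes "equiv X r" "equiv X s"
  shows "edges (levels X r s) = level_relation r s"
  unfolding levels_def by (rule edges_quotient[OF equiv_level_relation[OF assms]])

lemma ker_levels:
  assumes "equiv X r" "equiv X s"
  shows "ker (levels X r s) = r"
  by (simp add: ker_def edges_levels[OF assms] level_relation_def)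

lemma equiv_Id_on: "equiv X (Id_on X)"
  by (auto simp: equiv_def refl_on_def intro: symI transI)

text \<open>The right factor has no transversal block and is trivial on its level 0. So it adds only
  loops to the middle level, and level 2 is cut off from \<open>b\<close>.\<close>

lemma mult_levels_right:
  assumes b: "b \<in> partitions X" and s: "equiv X s"
  shows "partition_mult X b (levels X (Id_on X) s) = levels X (ker b) s"
proof (rule edges_inject)
  let ?G = "product_graph b (levels X (Id_on X) s)"
  have b': "edges b \<subseteq> (X \<times> {0, 1}) \<times> (X \<times> {0, 1})" "trans (edges b)" "refl_on (X \<times> {0, 1}) (edges b)"
    using equiv_edges[OF b] by (auto elim!: equivE)
  have s': "s \<subseteq> X \<times> X" "trans s" "refl_on X s"
    using s by (auto elim!: equivE)
  have G: "?G = edges b \<union> {((x, 1), (x, 1)) | x. x \<in> X} \<union> {((x, 2), (y, 2)) | x y. (x, y) \<in> s}"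
    unfolding product_graph_def edges_levels[OF equiv_Id_on s] lower_shift_level_relation by auto
  \<comment> \<open>A path stays either in levels 0 and 1 or in level 2. By transitivity of
    \<open>edges b\<close> and of \<open>s\<close> it collapses to a single edge.\<close>
  have reach: "(p, q) \<in> edges b \<or> (\<exists>x y. p = (x, 2) \<and> q = (y, 2) \<and> (x, y) \<in> s)"
    if "(p, q) \<in> ?G\<^sup>*" "p \<in> X \<times> {0, 1, 2}" for p q
    using that
  proof induction
    case base
    then show ?case using b'(3) s'(3) by (auto simp: refl_on_def)
  next
    case (step y z)
    then show ?case
      unfolding G using b'(1) by (auto intro: transD[OF b'(2)] transD[OF s'(2)])
  qed
  have lift: "?G \<subseteq> ?G\<^sup>*" by blast
  have "((x, 0), (y, 0)) \<in> ?G\<^sup>* \<longleftrightarrow> (x, y) \<in> ker b" if "x \<in> X" "y \<in> X" for x y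
    using reach[of "(x, 0)" "(y, 0)"] that lift unfolding G ker_def by auto
  moreover have "((x, 2), (y, 2)) \<in> ?G\<^sup>* \<longleftrightarrow> (x, y) \<in> s" if "x \<in> X" "y \<in> X" for x y
    using reach[of "(x, 2)" "(y, 2)"] that lift b'(1) unfolding G by auto
  moreover have "((x, 0), (y, 2)) \<notin> ?G\<^sup>*" "((x, 2), (y, 0)) \<notin> ?G\<^sup>*" if "x \<in> X" "y \<in> X" for x y
    using reach[of "(x, 0)" "(y, 2)"] reach[of "(x, 2)" "(y, 0)"] that b'(1) by auto
  moreover have "ker b \<subseteq> X \<times> X"
    using equiv_ker[OF b] by (auto elim: equivE)
  ultimately show "edges (partition_mult X b (levels X (Id_on X) s)) = edges (levels X (ker b) s)"
    unfolding edges_partition_mult[OF b levels_in_partitions[OF equiv_Id_on s]]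
      edges_levels[OF equiv_ker[OF b] s] level_relation_def
    using s'(1) by (auto simp: outer_def)
qed (use b s in \<open>auto intro: partition_mult_closed levels_in_partitions equiv_Id_on equiv_ker\<close>)

text \<open>Mirror image of \<open>mult_levels_right\<close>: the left factor adds only loops to the
  middle level, and level 0 is cut off from the shifted copy of \<open>b\<close>.\<close>

lemma mult_levels_left:
  assumes b: "b \<in> partitions X" and r: "equiv X r"
  shows "partition_mult X (levels X r (Id_on X)) b = levels X r (coker b)"
proof (rule edges_inject)
  let ?G = "product_graph (levels X r (Id_on X)) b"
  have b': "edges b \<subseteq> (X \<times> {0, 1}) \<times> (X \<times> {0, 1})" "trans (edges b)" "refl_on (X \<times> {0, 1}) (edges b)"
    using equiv_edges[OF b] by (auto elim!: equivE)
  have r': "r \<subseteq> X \<times> X" "trans r" "refl_on X r"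
    using r by (auto elim!: equivE)
  have G: "?G = {((x, Suc i), (y, Suc j)) | x i y j. ((x, i), (y, j)) \<in> edges b} \<union>
      {((x, 1), (x, 1)) | x. x \<in> X} \<union> {((x, 0), (y, 0)) | x y. (x, y) \<in> r}"
    unfolding product_graph_def edges_levels[OF r equiv_Id_on]
    by (force simp: level_relation_def lower_shift_def)
  \<comment> \<open>The shifted copy of \<open>b\<close> occupies the levels \<open>Suc i\<close>,
    and \<open>r\<close> lives on level 0. No path crosses between them.\<close>
  have reach: "(\<exists>x i y j. p = (x, Suc i) \<and> q = (y, Suc j) \<and> ((x, i), (y, j)) \<in> edges b) \<or>
      (\<exists>x y. p = (x, 0) \<and> q = (y, 0) \<and> (x, y) \<in> r)"
    if "(p, q) \<in> ?G\<^sup>*" "p \<in> X \<times> {0, 1, 2}" for p q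
    using that
  proof induction
    case base
    then show ?case using b'(3) r'(3) by (auto simp: refl_on_def numeral_2_eq_2)
  next
    case (step y z)
    then show ?case
      unfolding G using b'(1) by (auto intro: transD[OF b'(2)] transD[OF r'(2)])
  qed
  have lift: "?G \<subseteq> ?G\<^sup>*" by blast
  have "((x, 2), (y, 2)) \<in> ?G\<^sup>* \<longleftrightarrow> (x, y) \<in> coker b" if "x \<in> X" "y \<in> X" for x y
    using reach[of "(x, 2)" "(y, 2)"] that lift unfolding G coker_def by (auto simp: numeral_2_eq_2)
  moreover have "((x, 0), (y, 0)) \<in> ?G\<^sup>* \<longleftrightarrow> (x, y) \<in> r" if "x \<in> X" "y \<in> X" for x y
    using reach[of "(x, 0)" "(y, 0)"] that lift unfolding G by auto
  moreover have "((x, 0), (y, 2)) \<notin> ?G\<^sup>*" "((x, 2), (y, 0)) \<notin> ?G\<^sup>*" if "x \<in> X" "y \<in> X" for x y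
    using reach[of "(x, 0)" "(y, 2)"] reach[of "(x, 2)" "(y, 0)"] that by auto
  moreover have "coker b \<subseteq> X \<times> X"
    using equiv_coker[OF b] by (auto elim: equivE)
  ultimately show "edges (partition_mult X (levels X r (Id_on X)) b) = edges (levels X r (coker b))"
    unfolding edges_partition_mult[OF levels_in_partitions[OF r equiv_Id_on] b]
      edges_levels[OF r equiv_coker[OF b]] level_relation_def
    using r'(1) by (auto simp: outer_def)
qed (use b r in \<open>auto intro: partition_mult_closed levels_in_partitions equiv_Id_on equiv_coker\<close>)

lemma levels_ker_coker_mitsch:
  assumes b: "b \<in> partitions X"
  shows "(levels X (ker b) (coker b), b) \<in> mitsch_order (partition_monoid X)"
proof -
  note k = equiv_ker[OF b] and c = equiv_coker[OF b]
  let ?d = "levels X (ker b) (coker b)"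
  \<comment> \<open>Right multiplication by \<open>?x\<close> preserves the kernel, cuts the
    transversal blocks and makes \<open>coker b\<close> the cokernel. As \<open>b\<close> and
    \<open>?d\<close> have the same kernel, both are sent to \<open>?d\<close>. Dually,
    \<open>?y\<close> multiplies \<open>b\<close> on the left to \<open>?d\<close>.\<close>
  let ?x = "levels X (Id_on X) (coker b)" and ?y = "levels X (ker b) (Id_on X)"
  have d: "?d \<in> partitions X" by (rule levels_in_partitions[OF k c])
  have "?d = partition_mult X ?d ?x"
    by (simp add: mult_levels_right[OF d c] ker_levels[OF k c])
  moreover have "?d = partition_mult X b ?x"
    by (simp add: mult_levels_right[OF b c])
  moreover have "?d = partition_mult X ?y b"
    by (simp add: mult_levels_left[OF b k])
  moreover have "?x \<in> partitions X" "?y \<in> partitions X"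
    by (auto intro: levels_in_partitions equiv_Id_on k c)
  ultimately show ?thesis
    using b d unfolding mitsch_order_def partition_monoid_def by (simp, blast)
qed

section \<open>The composite relation and the join\<close>

text \<open>Every edge of \<open>levels X r s\<close> stays within one level, so the kernel and
  cokernel of \<open>a\<close> decide the inclusion.\<close>

lemma reverse_inclusion_levels:
  assumes a: "a \<in> partitions X" and r: "equiv X r" "r \<subseteq> ker a" and s: "equiv X s" "s \<subseteq> coker a"
  shows "(a, levels X r s) \<in> reverse_inclusion X"
  using assms levels_in_partitions[OF r(1) s(1)]
  by (auto simp: reverse_inclusion_def edges_levels level_relation_def ker_def coker_def)

lemma reverse_inclusion_O_mitsch_order:
  "reverse_inclusion X O mitsch_order (partition_monoid X) =
    {(a, b). a \<in> partitions X \<and> b \<in> partitions X \<and> ker b \<subseteq> ker a \<and> coker b \<subseteq> coker a}"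
proof (intro subset_antisym subrelI)
  fix a b assume "(a, b) \<in> reverse_inclusion X O mitsch_order (partition_monoid X)"
  then obtain d where "(a, d) \<in> reverse_inclusion X" "(d, b) \<in> mitsch_order (partition_monoid X)"
    by blast
  then show "(a, b) \<in> {(a, b). a \<in> partitions X \<and> b \<in> partitions X \<and> ker b \<subseteq> ker a \<and> coker b \<subseteq> coker a}"
    using reverse_inclusion_ker_coker[of a d X] mitsch_order_ker_coker[of d b X]
    by (auto simp: reverse_inclusion_def mitsch_order_def partition_monoid_def)
next
  fix a b assume "(a, b) \<in> {(a, b). a \<in> partitions X \<and> b \<in> partitions X \<and> ker b \<subseteq> ker a \<and> coker b \<subseteq> coker a}"
  \<comment> \<open>The intermediate element is \<open>levels X (ker b) (coker b)\<close>.\<close>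
  then show "(a, b) \<in> reverse_inclusion X O mitsch_order (partition_monoid X)"
    using reverse_inclusion_levels[of a X "ker b" "coker b"] levels_ker_coker_mitsch[of b X]
      equiv_ker[of b X] equiv_coker[of b X] by blast
qed

theorem corollary6p5:
  fixes X :: "'a set"
  shows "preorder_on (partitions X)
           (reverse_inclusion X O mitsch_order (partition_monoid X)) \<and>
         mitsch_order (partition_monoid X) O reverse_inclusion X
           \<subseteq> reverse_inclusion X O mitsch_order (partition_monoid X) \<and>
         is_preorder_join (partitions X)
           (reverse_inclusion X) (mitsch_order (partition_monoid X))
           (reverse_inclusion X O mitsch_order (partition_monoid X))"
proof -
  let ?r = "reverse_inclusion X" and ?s = "mitsch_order (partition_monoid X)"
  have pre: "preorder_on (partitions X) (?r O ?s)"
    unfolding reverse_inclusion_O_mitsch_order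
    by (auto simp: preorder_on_def refl_on_def intro!: transI)
  \<comment> \<open>Each relation embeds in the composite because the other one is
    reflexive.\<close>
  moreover have r: "?r \<subseteq> ?r O ?s" and s: "?s \<subseteq> ?r O ?s"
    using preorder_on_reverse_inclusion[of X] preorder_on_mitsch_order_partitions[of X]
    by (auto simp: preorder_on_def refl_on_def)
  \<comment> \<open>Both factors lie in the composite, which is transitive. The minimality claim
    below uses the same argument with \<open>u\<close>.\<close>
  moreover have "?s O ?r \<subseteq> ?r O ?s"
    using pre r s by (auto simp: preorder_on_def dest: transD)
  moreover have "?r O ?s \<subseteq> u" if "preorder_on (partitions X) u" "?r \<subseteq> u" "?s \<subseteq> u" for u
    using that by (auto simp: preorder_on_def dest: transD)
  ultimately show ?thesis
    using preorder_on_reverse_inclusion[of X] preorder_on_mitsch_order_partitions[of X]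
    by (auto simp: is_preorder_join_def)
qed

end
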